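(* For a lattice path $\nu$, let $P_\nu$ be the poset of $\nu$-Schröder trees (equivalently, up to isomorphism, the contraction poset of $\nu$-Schröder paths), and let $\widehat{P}_\nu$ denote $P_\nu$ with an adjoined minimal element $\hat 0$ and an adjoined maximal element $\hat 1$. If $\nu=(NE)^{n+1}$, then $P_\nu\cup\{\hat 0\}$ is isomorphic to the face lattice of the $n$-associahedron. For general $\nu$, $\widehat{P}_\nu$ is isomorphic to a sublattice of the face lattice of the $m$-associahedron, where $m$ is the number of steps in $\nu$.
   Context: The $n$-associahedron is the $n$-dimensional simple polytope whose poset of non-empty faces is isomorphic to the poset of diagonal dissections of a convex $(n+3)$-gon ordered by coarsening (minimal elements are the triangulations, the maximal element is the empty dissection); its face lattice is this poset together with a minimal element (the empty face). A lattice path from $(0,0)$ to $(b,a)\in\mathbb{Z}_{\ge0}^2$ is a sequence of $a$ north steps $N=(0,1)$ and $b$ east steps $E=(1,0)$. $R_\nu$ is the region weakly above $\nu$ inside the rectangle with corners $(0,0)$ and $(b,a)$. Two lattice points $p,q$ in $R_\nu$ are $\nu$-incompatible if $p$ is strictly southwest or strictly northeast of $q$ and the smallest rectangle containing $p$ and $q$ is contained in $R_\nu$; otherwise they are $\nu$-compatible. A $\nu$-Schröder tree is a set $T$ of pairwise $\nu$-compatible lattice points in $R_\nu$ which includes the point $(0,a)$ (the root) and such that each row and each column of the grid contains at least one point of $T$. The parent of a non-root point $p\in T$ is the nearest point of $T$ above $p$ in its column, or the nearest point of $T$ to the left of $p$ in its row, if one of these exists (both cannot exist); otherwise it is the unique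 point $q\in T$ strictly northwest of $p$ such that the box with opposite corners $p,q$ contains no other point of $T$. Contractions of a $\nu$-Schröder tree $S$: (right) if $q\in S$ has a point of $S$ above it in its column and a point of $S$ to its right in its row, remove $q$; (left) if $q\in S$ has a point of $S$ to its left in its row and a point of $S$ below it in its column, remove $q$; (diagonal) if $r\in S$ is strictly southeast of its parent $p$, with neither of the other two corners of the box determined by $p$ and $r$ in $S$, and $S\setminus\{r\}$ is a $\nu$-Schröder tree, remove $r$. The poset of $\nu$-Schröder trees has cover relation $T\prec T'$ iff $T'$ is a contraction of $T$. The paper shows this poset is isomorphic to its contraction poset of $\nu$-Schröder paths, so $P_\nu$ may be taken to be either.
   Formalization: ν is taken nonempty, and "sublattice" means: a subset containing the top, a lattice in the induced order, closed under all meets and under joins of pairs with a common upper bound in it below the top; closure under all joins fails for ν=EENN. *)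

theory Defs
  imports "HOL-Algebra.Lattice"
begin

section \<open>Orders, adjoined extrema, sublattices\<close>

definition discrete_eq_order :: "'a set \<Rightarrow> ('a \<Rightarrow> 'a \<Rightarrow> bool) \<Rightarrow> 'a gorder" where
  "discrete_eq_order A r = \<lparr>carrier = A, eq = (=), le = r\<rparr>"

definition order_isomorphic :: "'a gorder \<Rightarrow> 'b gorder \<Rightarrow> bool" where
  "order_isomorphic P Q \<longleftrightarrow> (\<exists>f. bij_betw f (carrier P) (carrier Q) \<and> order_emb P Q f)"

text \<open>In \<open>adjoin_bot\<close> the new element \<^term>\<open>None\<close> lies below everything,
  in \<open>adjoin_top\<close> it lies above everything.\<close>

definition adjoin_bot :: "'a gorder \<Rightarrow> 'a option gorder" where
  "adjoin_bot P = discrete_eq_order (insert None (Some ` carrier P))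
     (\<lambda>x y. case x of None \<Rightarrow> True
                    | Some p \<Rightarrow> (case y of None \<Rightarrow> False | Some q \<Rightarrow> p \<sqsubseteq>\<^bsub>P\<^esub> q))"

definition adjoin_top :: "'a gorder \<Rightarrow> 'a option gorder" where
  "adjoin_top P = discrete_eq_order (insert None (Some ` carrier P))
     (\<lambda>x y. case y of None \<Rightarrow> True
                    | Some q \<Rightarrow> (case x of None \<Rightarrow> False | Some p \<Rightarrow> p \<sqsubseteq>\<^bsub>P\<^esub> q))"

text \<open>
  A subset \<open>S\<close> of a lattice \<open>L\<close> that contains the top, is itself a lattice under the order
  induced from \<open>L\<close>, has the meets of \<open>L\<close>, and has the joins of \<open>L\<close> for all pairs with a common
  upper bound in \<open>S\<close> other than the top. Two elements of \<open>S\<close> without such a bound have the top as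
  their join in \<open>S\<close>; their join in \<open>L\<close> may be smaller (and then is not in \<open>S\<close>).

  Closure under the remaining joins cannot be required for the posets below. For the path
  \<open>EENN\<close>, put \<open>e = {(0,2),(1,2),(1,1),(2,0)}\<close>, \<open>e' = {(0,2),(1,1),(2,1),(2,0)}\<close> and
  \<open>d = {(0,2),(1,2),(2,1),(2,0)}\<close>. Then \<open>d\<close> lies above the meet \<open>e \<union> e'\<close> of \<open>e\<close> and \<open>e'\<close>, while
  \<open>d\<close> has join top with \<open>e\<close> and with \<open>e'\<close>. So the interval above \<open>e \<union> e'\<close> is not distributive,
  whereas the interval above any non-empty face of a simple polytope is Boolean.
\<close>

definition induced_sublattice :: "'a gorder \<Rightarrow> 'a set \<Rightarrow> bool" where
  "induced_sublattice L S \<longleftrightarrow>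
     lattice L \<and> S \<subseteq> carrier L \<and> \<top>\<^bsub>L\<^esub> \<in> S \<and> lattice (L\<lparr>carrier := S\<rparr>) \<and>
     (\<forall>x\<in>S. \<forall>y\<in>S. x \<sqinter>\<^bsub>L\<^esub> y \<in> S) \<and>
     (\<forall>x\<in>S. \<forall>y\<in>S. (\<exists>u\<in>S. u \<noteq> \<top>\<^bsub>L\<^esub> \<and> x \<sqsubseteq>\<^bsub>L\<^esub> u \<and> y \<sqsubseteq>\<^bsub>L\<^esub> u) \<longrightarrow> x \<squnion>\<^bsub>L\<^esub> y \<in> S)"

section \<open>The associahedron\<close>

text \<open>The vertices of the convex \<open>(n + 3)\<close>-gon are numbered \<open>0, \<dots>, n + 2\<close> cyclically; the
  diagonal joining \<open>i < j\<close> is the pair \<open>(i, j)\<close>.\<close>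

definition diagonals :: "nat \<Rightarrow> (nat \<times> nat) set" where
  "diagonals n = {(i, j). i + 2 \<le> j \<and> j \<le> n + 2 \<and> (i, j) \<noteq> (0, n + 2)}"

fun crossing :: "nat \<times> nat \<Rightarrow> nat \<times> nat \<Rightarrow> bool" where
  "crossing (i, j) (k, l) \<longleftrightarrow> i < k \<and> k < j \<and> j < l \<or> k < i \<and> i < l \<and> l < j"

definition dissections :: "nat \<Rightarrow> (nat \<times> nat) set set" where
  "dissections n = {D. D \<subseteq> diagonals n \<and> (\<forall>d\<in>D. \<forall>d'\<in>D. \<not> crossing d d')}"

text \<open>Non-empty faces are dissections ordered by coarsening; the empty face is \<^term>\<open>None\<close>.\<close>

definition associahedron_face_lattice :: "nat \<Rightarrow> (nat \<times> nat) set option gorder" where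
  "associahedron_face_lattice n =
     adjoin_bot (discrete_eq_order (dissections n) (\<lambda>D D'. D' \<subseteq> D))"

section \<open>Lattice paths and Schroeder trees\<close>

datatype step = N | E

type_synonym point = "nat \<times> nat"

definition width :: "step list \<Rightarrow> nat" where
  "width \<nu> = count_list \<nu> E"

definition height :: "step list \<Rightarrow> nat" where
  "height \<nu> = count_list \<nu> N"

definition path_points :: "step list \<Rightarrow> point set" where
  "path_points \<nu> = {(width (take k \<nu>), height (take k \<nu>)) | k. k \<le> length \<nu>}"

definition region :: "step list \<Rightarrow> point set" where
  "region \<nu> = {(x, y). x \<le> width \<nu> \<and> y \<le> height \<nu> \<and> (\<exists>y'\<le>y. (x, y') \<in> path_points \<nu>)}"

definition box :: "point \<Rightarrow> point \<Rightarrow> point set" where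
  "box p q = {min (fst p) (fst q)..max (fst p) (fst q)} \<times> {min (snd p) (snd q)..max (snd p) (snd q)}"

definition southwest :: "point \<Rightarrow> point \<Rightarrow> bool" where
  "southwest p q \<longleftrightarrow> fst p < fst q \<and> snd p < snd q"

definition northwest :: "point \<Rightarrow> point \<Rightarrow> bool" where
  "northwest p q \<longleftrightarrow> fst p < fst q \<and> snd q < snd p"

text \<open>A rectangle with lattice corners lies in the planar region above \<open>\<nu>\<close> iff all its lattice
  points do, since the region is bounded below by a lattice path.\<close>

definition incompatible :: "step list \<Rightarrow> point \<Rightarrow> point \<Rightarrow> bool" where
  "incompatible \<nu> p q \<longleftrightarrow> (southwest p q \<or> southwest q p) \<and> box p q \<subseteq> region \<nu>"

definition schroeder_tree :: "step list \<Rightarrow> point set \<Rightarrow> bool" where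
  "schroeder_tree \<nu> T \<longleftrightarrow>
     T \<subseteq> region \<nu> \<and> (\<forall>p\<in>T. \<forall>q\<in>T. \<not> incompatible \<nu> p q) \<and>
     (0, height \<nu>) \<in> T \<and>
     (\<forall>x\<le>width \<nu>. \<exists>y. (x, y) \<in> T) \<and> (\<forall>y\<le>height \<nu>. \<exists>x. (x, y) \<in> T)"

definition above :: "point set \<Rightarrow> point \<Rightarrow> point set" where
  "above T p = {q \<in> T. fst q = fst p \<and> snd p < snd q}"

definition below :: "point set \<Rightarrow> point \<Rightarrow> point set" where
  "below T p = {q \<in> T. fst q = fst p \<and> snd q < snd p}"

definition left_of :: "point set \<Rightarrow> point \<Rightarrow> point set" where
  "left_of T p = {q \<in> T. snd q = snd p \<and> fst q < fst p}"

definition right_of :: "point set \<Rightarrow> point \<Rightarrow> point set" where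
  "right_of T p = {q \<in> T. snd q = snd p \<and> fst p < fst q}"

definition is_parent :: "point set \<Rightarrow> point \<Rightarrow> point \<Rightarrow> bool" where
  "is_parent T q p \<longleftrightarrow>
     q \<in> above T p \<and> (\<forall>q'\<in>above T p. snd q \<le> snd q') \<or>
     q \<in> left_of T p \<and> (\<forall>q'\<in>left_of T p. fst q' \<le> fst q) \<or>
     above T p = {} \<and> left_of T p = {} \<and> q \<in> T \<and> northwest q p \<and> box q p \<inter> T \<subseteq> {q, p}"

definition right_contraction :: "point set \<Rightarrow> point set \<Rightarrow> bool" where
  "right_contraction S S' \<longleftrightarrow>
     (\<exists>q\<in>S. above S q \<noteq> {} \<and> right_of S q \<noteq> {} \<and> S' = S - {q})"

definition left_contraction :: "point set \<Rightarrow> point set \<Rightarrow> bool" where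
  "left_contraction S S' \<longleftrightarrow>
     (\<exists>q\<in>S. left_of S q \<noteq> {} \<and> below S q \<noteq> {} \<and> S' = S - {q})"

definition diagonal_contraction :: "step list \<Rightarrow> point set \<Rightarrow> point set \<Rightarrow> bool" where
  "diagonal_contraction \<nu> S S' \<longleftrightarrow>
     (\<exists>r\<in>S. \<exists>p\<in>S. is_parent S p r \<and> northwest p r \<and>
        (fst p, snd r) \<notin> S \<and> (fst r, snd p) \<notin> S \<and>
        S' = S - {r} \<and> schroeder_tree \<nu> S')"

definition contraction :: "step list \<Rightarrow> point set \<Rightarrow> point set \<Rightarrow> bool" where
  "contraction \<nu> S S' \<longleftrightarrow> schroeder_tree \<nu> S \<and>
     (right_contraction S S' \<or> left_contraction S S' \<or> diagonal_contraction \<nu> S S')"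

definition schroeder_tree_poset :: "step list \<Rightarrow> point set gorder" where
  "schroeder_tree_poset \<nu> = discrete_eq_order {T. schroeder_tree \<nu> T} (contraction \<nu>)\<^sup>*\<^sup>*"

end

theory Submission
  imports Defs
begin

text \<open>Contraction of \<open>\<nu>\<close>-Schroeder trees generates reverse inclusion: any point of a tree that a
  smaller tree avoids can be contracted. Two points of the region are incompatible iff they are in
  southwest position and the southeast corner of their box lies in the region. Placing the columns
  and rows on a polygon so that column \<open>x\<close> precedes row \<open>y\<close> iff \<open>(x, y)\<close> is in the region,
  points become chords and incompatibility becomes crossing; chords that are polygon edges belong
  to points lying in every tree. For general \<open>\<nu>\<close>, unions of trees that do not cross are trees, and
  so are intersections of trees that contain a common tree.\<close>

section \<open>Partial orders and sublattices\<close>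

lemma partial_order_discrete_eq_order:
  assumes "\<And>x. x \<in> A \<Longrightarrow> r x x"
    and "\<And>x y. \<lbrakk>x \<in> A; y \<in> A; r x y; r y x\<rbrakk> \<Longrightarrow> x = y"
    and "\<And>x y z. \<lbrakk>x \<in> A; y \<in> A; z \<in> A; r x y; r y z\<rbrakk> \<Longrightarrow> r x z"
  shows "partial_order (discrete_eq_order A r)"
  by unfold_locales
    (simp_all add: discrete_eq_order_def assms(1), (blast intro: assms(2,3))+)

lemma partial_order_adjoin_bot:
  assumes "partial_order P"
  shows "partial_order (adjoin_bot P)"
proof -
  interpret partial_order P by fact
  show ?thesis
    unfolding adjoin_bot_def
    by (rule partial_order_discrete_eq_order) (auto split: option.splits intro: le_trans)
qed

lemma partial_order_adjoin_top:
  assumes "partial_order P"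
  shows "partial_order (adjoin_top P)"
proof -
  interpret partial_order P by fact
  show ?thesis
    unfolding adjoin_top_def
    by (rule partial_order_discrete_eq_order) (auto split: option.splits intro: le_trans)
qed

lemma partial_order_subset:
  assumes "partial_order L" "S \<subseteq> carrier L"
  shows "partial_order (L\<lparr>carrier := S\<rparr>)"
proof -
  interpret partial_order L by fact
  show ?thesis
    by unfold_locales
      (use assms(2) in \<open>auto simp: eq_is_equal subset_iff intro: le_trans\<close>)
qed

text \<open>Two elements with the same image lie below each other by \<open>emb\<close>, so
  antisymmetry makes \<open>f\<close> injective; only surjectivity remains to be assumed.\<close>

lemma order_isomorphicI:
  assumes "partial_order P" "partial_order Q" "f ` carrier P = carrier Q"
    and emb: "\<And>x y. \<lbrakk>x \<in> carrier P; y \<in> carrier P\<rbrakk> \<Longrightarrow> f x \<sqsubseteq>\<^bsub>Q\<^esub> f y \<longleftrightarrow> x \<sqsubseteq>\<^bsub>P\<^esub> y"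
  shows "order_isomorphic P Q"
proof -
  interpret P: partial_order P by fact
  interpret Q: partial_order Q by fact
  have "inj_on f (carrier P)"
  proof (rule inj_onI)
    fix x y assume xy: "x \<in> carrier P" "y \<in> carrier P" "f x = f y"
    then have "f x \<in> carrier Q" using assms(3) by blast
    then have "f x \<sqsubseteq>\<^bsub>Q\<^esub> f y" "f y \<sqsubseteq>\<^bsub>Q\<^esub> f x" using xy(3) by auto
    then show "x = y" using emb xy P.le_antisym by blast
  qed
  then show ?thesis
    unfolding order_isomorphic_def order_emb_def bij_betw_def
    using assms P.weak_partial_order_axioms Q.weak_partial_order_axioms by blast
qed

text \<open>Uniqueness of greatest and least elements turns any witness in \<open>S\<close> into the
  meet or join chosen by the library, so it suffices to exhibit witnesses. The element
  \<open>t\<close> is thereby identified with the top.\<close>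

lemma induced_sublatticeI:
  assumes "lattice L" "S \<subseteq> carrier L" "t \<in> S" and top: "\<And>x. x \<in> carrier L \<Longrightarrow> x \<sqsubseteq>\<^bsub>L\<^esub> t"
    and meets: "\<And>x y. \<lbrakk>x \<in> S; y \<in> S\<rbrakk> \<Longrightarrow> \<exists>m\<in>S. greatest L m (Lower L {x, y})"
    and joins: "\<And>x y u. \<lbrakk>x \<in> S; y \<in> S; u \<in> S; u \<noteq> t; x \<sqsubseteq>\<^bsub>L\<^esub> u; y \<sqsubseteq>\<^bsub>L\<^esub> u\<rbrakk>
      \<Longrightarrow> \<exists>j\<in>S. least L j (Upper L {x, y})"
  shows "induced_sublattice L S"
proof -
  interpret lattice L by fact
  note SD = subsetD[OF assms(2)]
  have top_eq: "\<top>\<^bsub>L\<^esub> = t"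
  proof -
    have "greatest L t (carrier L)"
      using SD[OF assms(3)] top by (auto simp: greatest_def)
    then show ?thesis
      unfolding top_def by (metis (mono_tags) greatest_unique someI)
  qed
  have meet_in: "x \<sqinter>\<^bsub>L\<^esub> y \<in> S" if "x \<in> S" "y \<in> S" for x y
  proof (rule meetI)
    fix i assume "greatest L i (Lower L {x, y})"
    with meets[OF that] show "i \<in> S" using greatest_unique by blast
  qed (use that SD in auto)
  have join_in: "x \<squnion>\<^bsub>L\<^esub> y \<in> S"
    if "x \<in> S" "y \<in> S" "u \<in> S" "u \<noteq> t" "x \<sqsubseteq>\<^bsub>L\<^esub> u" "y \<sqsubseteq>\<^bsub>L\<^esub> u" for x y u
  proof (rule joinI)
    fix i assume "least L i (Upper L {x, y})"
    with joins[OF that] show "i \<in> S" using least_unique by blast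
  qed (use that SD in auto)
  interpret S: partial_order "L\<lparr>carrier := S\<rparr>"
    by (rule partial_order_subset) (use assms(2) in \<open>auto intro: partial_order_axioms\<close>)
  have "lattice (L\<lparr>carrier := S\<rparr>)"
  proof
    fix x y assume "x \<in> carrier (L\<lparr>carrier := S\<rparr>)" "y \<in> carrier (L\<lparr>carrier := S\<rparr>)"
    then have xy: "x \<in> S" "y \<in> S" by auto
    show "\<exists>s. least (L\<lparr>carrier := S\<rparr>) s (Upper (L\<lparr>carrier := S\<rparr>) {x, y})"
    proof (cases "\<exists>u\<in>S. u \<noteq> t \<and> x \<sqsubseteq>\<^bsub>L\<^esub> u \<and> y \<sqsubseteq>\<^bsub>L\<^esub> u")
      case True
      with xy have "x \<squnion>\<^bsub>L\<^esub> y \<in> S" using join_in by blast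
      then have "least (L\<lparr>carrier := S\<rparr>) (x \<squnion>\<^bsub>L\<^esub> y) (Upper (L\<lparr>carrier := S\<rparr>) {x, y})"
        using xy SD join_left join_right join_le by (auto simp: least_def Upper_def)
      then show ?thesis ..
    next
      case False
      \<comment> \<open>Here \<open>t\<close> is the only common upper bound inside
        \<open>S\<close>, hence the join in \<open>S\<close>, even if the join in \<open>L\<close>
        is smaller.\<close>
      then have "least (L\<lparr>carrier := S\<rparr>) t (Upper (L\<lparr>carrier := S\<rparr>) {x, y})"
        using xy SD assms(3) top le_refl by (auto simp: least_def Upper_def)
      then show ?thesis ..
    qed
    have "greatest (L\<lparr>carrier := S\<rparr>) (x \<sqinter>\<^bsub>L\<^esub> y) (Lower (L\<lparr>carrier := S\<rparr>) {x, y})"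
      using xy meet_in SD meet_left meet_right meet_le by (auto simp: greatest_def Lower_def)
    then show "\<exists>s. greatest (L\<lparr>carrier := S\<rparr>) s (Lower (L\<lparr>carrier := S\<rparr>) {x, y})" ..
  qed
  then show ?thesis
    unfolding induced_sublattice_def top_eq
    using assms(1-3) meet_in join_in by blast
qed

lemma Upper_pair_iff:
  "\<lbrakk>x \<in> carrier L; y \<in> carrier L\<rbrakk> \<Longrightarrow>
    z \<in> Upper L {x, y} \<longleftrightarrow> z \<in> carrier L \<and> x \<sqsubseteq>\<^bsub>L\<^esub> z \<and> y \<sqsubseteq>\<^bsub>L\<^esub> z"
  by (auto simp: Upper_def)

lemma Lower_pair_iff:
  "\<lbrakk>x \<in> carrier L; y \<in> carrier L\<rbrakk> \<Longrightarrow>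
    z \<in> Lower L {x, y} \<longleftrightarrow> z \<in> carrier L \<and> z \<sqsubseteq>\<^bsub>L\<^esub> x \<and> z \<sqsubseteq>\<^bsub>L\<^esub> y"
  by (auto simp: Lower_def)

section \<open>The face lattice of the associahedron\<close>

lemma face_lattice_carrier:
  "carrier (associahedron_face_lattice n) = insert None (Some ` dissections n)"
  by (simp add: associahedron_face_lattice_def adjoin_bot_def discrete_eq_order_def)

lemma face_lattice_le [simp]:
  "None \<sqsubseteq>\<^bsub>associahedron_face_lattice n\<^esub> y"
  "\<not> Some D \<sqsubseteq>\<^bsub>associahedron_face_lattice n\<^esub> None"
  "Some D \<sqsubseteq>\<^bsub>associahedron_face_lattice n\<^esub> Some D' \<longleftrightarrow> D' \<subseteq> D"
  by (simp_all add: associahedron_face_lattice_def adjoin_bot_def discrete_eq_order_def)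

lemma dissections_antimono: "\<lbrakk>D \<in> dissections n; D' \<subseteq> D\<rbrakk> \<Longrightarrow> D' \<in> dissections n"
  by (auto simp: dissections_def)

lemma partial_order_face_lattice: "partial_order (associahedron_face_lattice n)"
  unfolding associahedron_face_lattice_def
  by (intro partial_order_adjoin_bot partial_order_discrete_eq_order) auto

text \<open>The order is reverse inclusion, so common upper bounds are the subsets of both
  dissections, and any subset of a dissection is again one.\<close>

lemma face_lattice_join_Some:
  assumes "D \<in> dissections n" "D' \<in> dissections n"
  shows "least (associahedron_face_lattice n) (Some (D \<inter> D'))
    (Upper (associahedron_face_lattice n) {Some D, Some D'})"
proof -
  have "Some (D \<inter> D') \<sqsubseteq>\<^bsub>associahedron_face_lattice n\<^esub> z"
    if "Some D \<sqsubseteq>\<^bsub>associahedron_face_lattice n\<^esub> z" "Some D' \<sqsubseteq>\<^bsub>associahedron_face_lattice n\<^esub> z" for z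
    using that by (cases z) auto
  moreover have "D \<inter> D' \<in> dissections n" using assms(1) dissections_antimono by blast
  ultimately show ?thesis
    using assms by (auto simp: least_def Upper_pair_iff face_lattice_carrier simp del: Int_iff)
qed

lemma face_lattice_join_None:
  assumes "y \<in> carrier (associahedron_face_lattice n)"
  shows "least (associahedron_face_lattice n) y (Upper (associahedron_face_lattice n) {None, y})"
proof -
  interpret partial_order "associahedron_face_lattice n"
    by (rule partial_order_face_lattice)
  have "None \<in> carrier (associahedron_face_lattice n)" by (simp add: face_lattice_carrier)
  then show ?thesis
    using assms by (auto simp: least_def Upper_pair_iff)
qed

text \<open>A dissection below both contains the union, and then the union is itself a dissection.
  If the union has a crossing, only the empty face \<open>None\<close> is left.\<close>

lemma face_lattice_meet_Some:
  assumes "D \<in> dissections n" "D' \<in> dissections n"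
  shows "greatest (associahedron_face_lattice n)
    (if D \<union> D' \<in> dissections n then Some (D \<union> D') else None)
    (Lower (associahedron_face_lattice n) {Some D, Some D'})"
proof -
  let ?m = "if D \<union> D' \<in> dissections n then Some (D \<union> D') else None"
  have "z \<sqsubseteq>\<^bsub>associahedron_face_lattice n\<^esub> ?m"
    if z: "z \<in> carrier (associahedron_face_lattice n)"
      "z \<sqsubseteq>\<^bsub>associahedron_face_lattice n\<^esub> Some D" "z \<sqsubseteq>\<^bsub>associahedron_face_lattice n\<^esub> Some D'" for z
  proof (cases z)
    case (Some C)
    with z have "C \<in> dissections n" "D \<union> D' \<subseteq> C"
      by (auto simp: face_lattice_carrier)
    then show ?thesis using Some dissections_antimono by auto
  qed simp
  moreover have "?m \<in> carrier (associahedron_face_lattice n)"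
    by (auto simp: face_lattice_carrier)
  moreover have "?m \<sqsubseteq>\<^bsub>associahedron_face_lattice n\<^esub> Some D"
      "?m \<sqsubseteq>\<^bsub>associahedron_face_lattice n\<^esub> Some D'"
    by auto
  moreover have "Some D \<in> carrier (associahedron_face_lattice n)"
      "Some D' \<in> carrier (associahedron_face_lattice n)"
    using assms by (auto simp: face_lattice_carrier)
  ultimately show ?thesis
    unfolding greatest_def by (simp only: Lower_pair_iff) (blast intro: Lower_closed[THEN subsetD])
qed

lemma face_lattice_meet_None:
  assumes "y \<in> carrier (associahedron_face_lattice n)"
  shows "greatest (associahedron_face_lattice n) None
    (Lower (associahedron_face_lattice n) {None, y})"
proof -
  have "None \<in> carrier (associahedron_face_lattice n)" by (simp add: face_lattice_carrier)
  then show ?thesis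
    using assms by (simp add: greatest_def Lower_pair_iff)
qed

lemma lattice_face_lattice: "lattice (associahedron_face_lattice n)"
proof -
  let ?L = "associahedron_face_lattice n"
  interpret partial_order ?L by (rule partial_order_face_lattice)
  show ?thesis
  proof
    fix x y assume xy: "x \<in> carrier ?L" "y \<in> carrier ?L"
    show "\<exists>s. least ?L s (Upper ?L {x, y})"
    proof (cases "x = None \<or> y = None")
      case True
      then have "{x, y} = {None, x} \<or> {x, y} = {None, y}" by auto
      then show ?thesis
        using face_lattice_join_None[OF xy(1)] face_lattice_join_None[OF xy(2)] by (elim disjE) auto
    next
      case False
      then obtain D D' where "x = Some D" "y = Some D'" by auto
      then show ?thesis
        using xy face_lattice_join_Some[of D n D'] unfolding face_lattice_carrier by blast
    qed
    show "\<exists>s. greatest ?L s (Lower ?L {x, y})"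
    proof (cases "x = None \<or> y = None")
      case True
      then have "{x, y} = {None, x} \<or> {x, y} = {None, y}" by auto
      then show ?thesis
        using face_lattice_meet_None[OF xy(1)] face_lattice_meet_None[OF xy(2)] by (elim disjE) auto
    next
      case False
      then obtain D D' where "x = Some D" "y = Some D'" by auto
      then show ?thesis
        using xy face_lattice_meet_Some[of D n D'] unfolding face_lattice_carrier by blast
    qed
  qed
qed

section \<open>The region above a lattice path\<close>

lemma width_simps [simp]: "width [] = 0" "width (N # \<nu>) = width \<nu>" "width (E # \<nu>) = Suc (width \<nu>)"
  by (simp_all add: width_def)

lemma height_simps [simp]:
  "height [] = 0" "height (N # \<nu>) = Suc (height \<nu>)" "height (E # \<nu>) = height \<nu>"
  by (simp_all add: height_def)

lemma width_append [simp]: "width (\<mu> @ \<nu>) = width \<mu> + width \<nu>"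
  by (simp add: width_def)

lemma height_append [simp]: "height (\<mu> @ \<nu>) = height \<mu> + height \<nu>"
  by (simp add: height_def)

lemma length_eq_height_plus_width: "length \<nu> = height \<nu> + width \<nu>"
proof (induction \<nu>)
  case (Cons s \<nu>)
  then show ?case by (cases s) auto
qed simp

lemma height_take_mono: "k \<le> l \<Longrightarrow> height (take k \<nu>) \<le> height (take l \<nu>)"
  by (metis height_append le_add1 le_iff_add take_add)

text \<open>Discrete intermediate values: one more step raises the width by at most 1.\<close>

lemma take_width_surj: "x \<le> width (take k \<nu>) \<Longrightarrow> \<exists>j\<le>k. width (take j \<nu>) = x"
proof (induction k)
  case (Suc k)
  show ?case
  proof (cases "x \<le> width (take k \<nu>)")
    case True
    then show ?thesis using Suc.IH le_Suc_eq by blast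
  next
    case False
    moreover have "width (take (Suc k) \<nu>) \<le> Suc (width (take k \<nu>))"
      by (cases "k < length \<nu>"; cases "\<nu> ! k") (auto simp: take_Suc_conv_app_nth)
    ultimately have "width (take (Suc k) \<nu>) = x" using Suc.prems by linarith
    then show ?thesis by blast
  qed
qed simp

lemma region_bounds: "(x, y) \<in> region \<nu> \<Longrightarrow> x \<le> width \<nu> \<and> y \<le> height \<nu>"
  by (auto simp: region_def)

lemma finite_region: "finite (region \<nu>)"
  by (rule finite_subset[of _ "{..width \<nu>} \<times> {..height \<nu>}"]) (auto simp: region_def)

lemma region_up: "\<lbrakk>(x, y) \<in> region \<nu>; y \<le> y'; y' \<le> height \<nu>\<rbrakk> \<Longrightarrow> (x, y') \<in> region \<nu>"
  by (auto simp: region_def intro: order_trans)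

text \<open>Some prefix of the path meets column \<open>x\<close> at height at most
  \<open>y\<close>. A shorter prefix meets column \<open>x'\<close>, at no greater height.\<close>

lemma region_left:
  assumes "(x, y) \<in> region \<nu>" "x' \<le> x"
  shows "(x', y) \<in> region \<nu>"
proof -
  obtain k where k: "k \<le> length \<nu>" "x = width (take k \<nu>)" "height (take k \<nu>) \<le> y"
    using assms(1) by (auto simp: region_def path_points_def)
  then obtain j where j: "j \<le> k" "width (take j \<nu>) = x'"
    using take_width_surj assms(2) by blast
  have "(x', height (take j \<nu>)) \<in> path_points \<nu>"
    using j k by (auto simp: path_points_def)
  moreover have "height (take j \<nu>) \<le> y"
    using k(3) height_take_mono[OF j(1)] order_trans by blast
  ultimately show ?thesis
    using region_bounds[OF assms(1)] assms(2) by (auto simp: region_def)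
qed

lemma region_top: "x \<le> width \<nu> \<Longrightarrow> (x, height \<nu>) \<in> region \<nu>"
  by (rule region_left[of "width \<nu>"]) (force simp: region_def path_points_def)+

lemma region_leftmost: "y \<le> height \<nu> \<Longrightarrow> (0, y) \<in> region \<nu>"
  by (auto simp: region_def path_points_def intro!: exI[of _ 0])

text \<open>The region is closed under moving left and, up to the top row, under moving up. Hence
  the box lies in it as soon as its southeast corner does.\<close>

lemma incompatible_iff:
  assumes "p \<in> region \<nu>" "q \<in> region \<nu>"
  shows "incompatible \<nu> p q \<longleftrightarrow>
    southwest p q \<and> (fst q, snd p) \<in> region \<nu> \<or> southwest q p \<and> (fst p, snd q) \<in> region \<nu>"
proof -
  have *: "box p q \<subseteq> region \<nu> \<longleftrightarrow> (fst q, snd p) \<in> region \<nu>"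
    if "southwest p q" "q \<in> region \<nu>" for p q
  proof
    assume "box p q \<subseteq> region \<nu>"
    moreover have "(fst q, snd p) \<in> box p q" using that(1) by (auto simp: box_def southwest_def)
    ultimately show "(fst q, snd p) \<in> region \<nu>" by blast
  next
    assume corner: "(fst q, snd p) \<in> region \<nu>"
    show "box p q \<subseteq> region \<nu>"
    proof
      fix z assume "z \<in> box p q"
      moreover obtain u v where z: "z = (u, v)" by fastforce
      ultimately have uv: "u \<le> fst q" "snd p \<le> v" "v \<le> snd q"
        using that(1) by (auto simp: box_def southwest_def)
      moreover have "snd q \<le> height \<nu>" using that(2) region_bounds by (cases q) auto
      ultimately show "z \<in> region \<nu>"
        using region_up[OF region_left[OF corner uv(1)] uv(2)] z uv by auto
    qed
  qed
  have "box p q = box q p" by (auto simp: box_def min.commute max.commute)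
  then show ?thesis
    using *[of p q] *[of q p] assms unfolding incompatible_def by blast
qed

section \<open>Contraction of Schroeder trees is reverse inclusion\<close>

lemma schroeder_tree_region: "\<lbrakk>schroeder_tree \<nu> T; (x, y) \<in> T\<rbrakk> \<Longrightarrow> (x, y) \<in> region \<nu>"
  by (auto simp: schroeder_tree_def)

lemma schroeder_tree_root: "schroeder_tree \<nu> T \<Longrightarrow> (0, height \<nu>) \<in> T"
  by (simp add: schroeder_tree_def)

lemma schroeder_tree_col:
  assumes "schroeder_tree \<nu> T" "x \<le> width \<nu>"
  obtains y where "(x, y) \<in> T"
  using assms by (auto simp: schroeder_tree_def)

lemma schroeder_tree_row:
  assumes "schroeder_tree \<nu> T" "y \<le> height \<nu>"
  obtains x where "(x, y) \<in> T"
  using assms by (auto simp: schroeder_tree_def)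

lemma schroeder_tree_subset:
  assumes "schroeder_tree \<nu> T" "S \<subseteq> T" "(0, height \<nu>) \<in> S"
    and "\<And>x. x \<le> width \<nu> \<Longrightarrow> \<exists>y. (x, y) \<in> S" "\<And>y. y \<le> height \<nu> \<Longrightarrow> \<exists>x. (x, y) \<in> S"
  shows "schroeder_tree \<nu> S"
  using assms unfolding schroeder_tree_def by blast

text \<open>Compatibility is inherited from the larger tree; the root and the covering of rows and
  columns come from the smaller one.\<close>

lemma schroeder_tree_between:
  assumes "schroeder_tree \<nu> T" "schroeder_tree \<nu> T'" "T' \<subseteq> S" "S \<subseteq> T"
  shows "schroeder_tree \<nu> S"
proof (rule schroeder_tree_subset[OF assms(1,4)])
  show "(0, height \<nu>) \<in> S" using schroeder_tree_root assms(2,3) by blast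
  show "\<exists>y. (x, y) \<in> S" if "x \<le> width \<nu>" for x
    using schroeder_tree_col[OF assms(2) that] assms(3) by blast
  show "\<exists>x. (x, y) \<in> S" if "y \<le> height \<nu>" for y
    using schroeder_tree_row[OF assms(2) that] assms(3) by blast
qed

lemma schroeder_tree_remove:
  assumes T: "schroeder_tree \<nu> T" and root: "q \<noteq> (0, height \<nu>)"
    and x: "(x, snd q) \<in> T" "x \<noteq> fst q" and y: "(fst q, y) \<in> T" "y \<noteq> snd q"
  shows "schroeder_tree \<nu> (T - {q})"
proof (rule schroeder_tree_subset[OF T])
  show "(0, height \<nu>) \<in> T - {q}"
    using schroeder_tree_root[OF T] root by blast
  show "\<exists>v. (u, v) \<in> T - {q}" if u: "u \<le> width \<nu>" for u
  proof (cases "u = fst q")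
    case True
    then have "(u, y) \<in> T - {q}" using y by (cases q) simp
    then show ?thesis ..
  next
    case False
    obtain v where "(u, v) \<in> T" using schroeder_tree_col[OF T u] .
    then have "(u, v) \<in> T - {q}" using False by (cases q) simp
    then show ?thesis ..
  qed
  show "\<exists>u. (u, v) \<in> T - {q}" if v: "v \<le> height \<nu>" for v
  proof (cases "v = snd q")
    case True
    then have "(x, v) \<in> T - {q}" using x by (cases q) simp
    then show ?thesis ..
  next
    case False
    obtain u where "(u, v) \<in> T" using schroeder_tree_row[OF T v] .
    then have "(u, v) \<in> T - {q}" using False by (cases q) simp
    then show ?thesis ..
  qed
qed blast

text \<open>Right and left contractions remove a point with another point in its row and another in
  its column, so the covering survives. For diagonal contractions the definition demands a
  tree.\<close>

lemma contraction_imp_schroeder_tree: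
  assumes "contraction \<nu> S S'"
  shows "schroeder_tree \<nu> S' \<and> S' \<subseteq> S"
proof -
  have S: "schroeder_tree \<nu> S" using assms by (simp add: contraction_def)
  consider "right_contraction S S'" | "left_contraction S S'" | "diagonal_contraction \<nu> S S'"
    using assms by (auto simp: contraction_def)
  then show ?thesis
  proof cases
    case 1
    then obtain q where q: "q \<in> S" "above S q \<noteq> {}" "right_of S q \<noteq> {}" "S' = S - {q}"
      unfolding right_contraction_def by blast
    obtain y where y: "(fst q, y) \<in> S" "snd q < y"
      using q(2) by (auto simp: above_def)
    obtain x where x: "(x, snd q) \<in> S" "fst q < x"
      using q(3) by (auto simp: right_of_def)
    \<comment> \<open>A point above \<open>q\<close> shows that \<open>q\<close> is not in the top
      row, so the root is kept.\<close>
    have "y \<le> height \<nu>" using region_bounds schroeder_tree_region[OF S y(1)] by blast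
    then have "q \<noteq> (0, height \<nu>)" using y(2) by auto
    then have "schroeder_tree \<nu> (S - {q})"
      using schroeder_tree_remove[OF S _ x(1) _ y(1)] x(2) y(2) by simp
    then show ?thesis using q(4) by blast
  next
    case 2
    then obtain q where q: "q \<in> S" "left_of S q \<noteq> {}" "below S q \<noteq> {}" "S' = S - {q}"
      unfolding left_contraction_def by blast
    obtain y where y: "(fst q, y) \<in> S" "y < snd q"
      using q(3) by (auto simp: below_def)
    obtain x where x: "(x, snd q) \<in> S" "x < fst q"
      using q(2) by (auto simp: left_of_def)
    then have "q \<noteq> (0, height \<nu>)" by auto
    then have "schroeder_tree \<nu> (S - {q})"
      using schroeder_tree_remove[OF S _ x(1) _ y(1)] x(2) y(2) by simp
    then show ?thesis using q(4) by blast
  next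
    case 3
    then show ?thesis by (auto simp: diagonal_contraction_def)
  qed
qed

text \<open>The left neighbour \<open>b\<close> would be southwest of \<open>a\<close>, with
  \<open>q\<close> as the southeast corner of their box.\<close>

lemma no_above_and_left:
  assumes T: "schroeder_tree \<nu> T" and "q \<in> T" "a \<in> above T q" "b \<in> left_of T q"
  shows False
proof -
  have mem: "a \<in> T" "b \<in> T" using assms by (auto simp: above_def left_of_def)
  then have reg: "a \<in> region \<nu>" "b \<in> region \<nu>" "q \<in> region \<nu>"
    using T assms(2) by (auto simp: schroeder_tree_def)
  have "southwest b a" "(fst a, snd b) = q"
    using assms(3,4) by (auto simp: above_def left_of_def southwest_def)
  then have "incompatible \<nu> b a"
    using reg by (simp add: incompatible_iff)
  then show False using T mem by (auto simp: schroeder_tree_def)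
qed

text \<open>The parent is the point northwest of \<open>q\<close> that is nearest in the taxicab metric.\<close>

lemma northwest_parent_exists:
  assumes T: "schroeder_tree \<nu> T" and "q \<in> T" "q \<noteq> (0, height \<nu>)" "above T q = {}" "left_of T q = {}"
  obtains p where "p \<in> T" "northwest p q" "is_parent T p q"
proof -
  let ?d = "\<lambda>p. (fst q - fst p) + (snd p - snd q)"
  let ?NW = "{p \<in> T. northwest p q}"
  have mem: "(0, height \<nu>) \<in> T" using T by (rule schroeder_tree_root)
  have "snd q \<le> height \<nu>"
    using schroeder_tree_region[OF T, of "fst q" "snd q"] assms(2) region_bounds by fastforce
  moreover have "(0, height \<nu>) \<notin> above T q" "(0, height \<nu>) \<notin> left_of T q"
    using assms(4,5) by blast+
  \<comment> \<open>If \<open>q\<close> shared a column or a row with the root, the root would lie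
    in \<open>above T q\<close> or \<open>left_of T q\<close>.\<close>
  ultimately have "0 < fst q" "snd q < height \<nu>"
    using mem assms(3) by (cases q; force simp: above_def left_of_def)+
  then have root: "(0, height \<nu>) \<in> ?NW"
    using mem by (simp add: northwest_def)
  have "\<exists>p\<in>?NW. \<forall>p'\<in>?NW. ?d p \<le> ?d p'"
    using ex_has_least_nat[of "\<lambda>p. p \<in> ?NW" "(0, height \<nu>)" ?d] root by blast
  then obtain p where p: "p \<in> T" "northwest p q" "\<And>p'. \<lbrakk>p' \<in> T; northwest p' q\<rbrakk> \<Longrightarrow> ?d p \<le> ?d p'"
    by blast
  have "box p q \<inter> T \<subseteq> {p, q}"
  proof
    fix z assume z: "z \<in> box p q \<inter> T"
    then have b: "fst p \<le> fst z" "fst z \<le> fst q" "snd q \<le> snd z" "snd z \<le> snd p"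
      using p(2) by (auto simp: box_def northwest_def)
    show "z \<in> {p, q}"
    proof (cases "northwest z q")
      case True
      then have "?d p \<le> ?d z" using p(3) z by blast
      then have "fst z = fst p \<and> snd z = snd p"
        using b True p(2) unfolding northwest_def by linarith
      then show ?thesis by (simp add: prod_eq_iff)
    next
      case False
      then have "fst z = fst q \<or> snd z = snd q"
        using b by (auto simp: northwest_def)
      moreover have "z \<notin> above T q" "z \<notin> left_of T q" using assms(4,5) by blast+
      ultimately have "fst z = fst q \<and> snd z = snd q"
        using b z by (auto simp: above_def left_of_def)
      then show ?thesis by (simp add: prod_eq_iff)
    qed
  qed
  then have "is_parent T p q"
    using p assms(4,5) by (auto simp: is_parent_def)
  then show thesis using that p by blast
qed

text \<open>Since \<open>T'\<close> covers the row and column of \<open>q\<close> without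
  \<open>q\<close>, both contain further points of \<open>T\<close>. A point above \<open>q\<close>
  excludes one on its left and forces one on its right; a point on the left forces one below. With
  neither, the parent is northwest of \<open>q\<close> and the contraction is diagonal.\<close>

lemma contraction_removal:
  assumes T: "schroeder_tree \<nu> T" and T': "schroeder_tree \<nu> T'" and "T' \<subseteq> T" "q \<in> T - T'"
  shows "contraction \<nu> T (T - {q})"
proof -
  have tree: "schroeder_tree \<nu> (T - {q})"
    using assms by (intro schroeder_tree_between[OF T T']) auto
  have "q \<in> T" "q \<in> region \<nu>" and root: "q \<noteq> (0, height \<nu>)"
    using assms by (auto simp: schroeder_tree_def)
  then have "fst q \<le> width \<nu>" "snd q \<le> height \<nu>"
    using region_bounds[of "fst q" "snd q"] by auto
  then obtain x y where xy: "(fst q, y) \<in> T - {q}" "(x, snd q) \<in> T - {q}"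
    using schroeder_tree_col[OF tree] schroeder_tree_row[OF tree] by metis
  then have "x \<noteq> fst q" "y \<noteq> snd q" by auto
  then have row: "left_of T q \<noteq> {} \<or> right_of T q \<noteq> {}" and col: "above T q \<noteq> {} \<or> below T q \<noteq> {}"
    using xy by (force simp: left_of_def right_of_def above_def below_def neq_iff)+
  consider "above T q \<noteq> {}" | "left_of T q \<noteq> {}" | "above T q = {}" "left_of T q = {}" by blast
  then show ?thesis
  proof cases
    case 1
    then have "right_of T q \<noteq> {}" using row no_above_and_left[OF T \<open>q \<in> T\<close>] by blast
    then show ?thesis
      using 1 \<open>q \<in> T\<close> T by (auto simp: contraction_def right_contraction_def)
  next
    case 2
    then have "below T q \<noteq> {}" using col no_above_and_left[OF T \<open>q \<in> T\<close>] by blast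
    then show ?thesis
      using 2 \<open>q \<in> T\<close> T by (auto simp: contraction_def left_contraction_def)
  next
    case 3
    obtain p where p: "p \<in> T" "northwest p q" "is_parent T p q"
      using northwest_parent_exists[OF T \<open>q \<in> T\<close> root 3] .
    have "(fst p, snd q) \<notin> T" "(fst q, snd p) \<notin> T"
      using 3 p(2) by (auto simp: above_def left_of_def northwest_def)
    then have "diagonal_contraction \<nu> T (T - {q})"
      using p \<open>q \<in> T\<close> tree unfolding diagonal_contraction_def by blast
    then show ?thesis using T by (simp add: contraction_def)
  qed
qed

text \<open>For the converse, the finitely many points of \<open>T - T'\<close> are contracted one
  at a time; every intermediate set still contains \<open>T'\<close>.\<close>

lemma contraction_rtranclp_iff:
  assumes T: "schroeder_tree \<nu> T"
  shows "(contraction \<nu>)\<^sup>*\<^sup>* T T' \<longleftrightarrow> schroeder_tree \<nu> T' \<and> T' \<subseteq> T"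
proof
  assume "(contraction \<nu>)\<^sup>*\<^sup>* T T'"
  then show "schroeder_tree \<nu> T' \<and> T' \<subseteq> T"
    by induction (use T contraction_imp_schroeder_tree in blast)+
next
  assume T': "schroeder_tree \<nu> T' \<and> T' \<subseteq> T"
  have "finite T" using T finite_subset[OF _ finite_region] by (auto simp: schroeder_tree_def)
  then have "finite (T - T')" by simp
  then show "(contraction \<nu>)\<^sup>*\<^sup>* T T'"
    using T T'
  proof (induction "T - T'" arbitrary: T rule: finite_psubset_induct)
    case psubset
    show ?case
    proof (cases "T = T'")
      case False
      then obtain q where q: "q \<in> T - T'" using psubset.prems by blast
      have step: "contraction \<nu> T (T - {q})"
        using contraction_removal psubset.prems q by blast
      have "(contraction \<nu>)\<^sup>*\<^sup>* (T - {q}) T'"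
        using psubset.hyps(2)[of "T - {q}"] contraction_imp_schroeder_tree[OF step] psubset.prems q
        by blast
      with step show ?thesis by (rule converse_rtranclp_into_rtranclp)
    qed simp
  qed
qed

lemma tree_poset_carrier: "carrier (schroeder_tree_poset \<nu>) = {T. schroeder_tree \<nu> T}"
  by (simp add: schroeder_tree_poset_def discrete_eq_order_def)

lemma tree_poset_le:
  "\<lbrakk>schroeder_tree \<nu> T; schroeder_tree \<nu> T'\<rbrakk> \<Longrightarrow> T \<sqsubseteq>\<^bsub>schroeder_tree_poset \<nu>\<^esub> T' \<longleftrightarrow> T' \<subseteq> T"
  by (simp add: schroeder_tree_poset_def discrete_eq_order_def contraction_rtranclp_iff)

lemma partial_order_tree_poset: "partial_order (schroeder_tree_poset \<nu>)"
  unfolding schroeder_tree_poset_def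
  by (rule partial_order_discrete_eq_order) (auto simp: contraction_rtranclp_iff)

section \<open>Schroeder trees as dissections\<close>

text \<open>Columns and rows are placed at polygon vertices \<open>c x\<close> and \<open>r y\<close>.\<close>

locale grid_embedding =
  fixes \<nu> :: "step list" and n :: nat and c r :: "nat \<Rightarrow> nat"
  assumes c_less: "\<lbrakk>x < x'; x' \<le> width \<nu>\<rbrakk> \<Longrightarrow> c x < c x'"
    and r_less: "\<lbrakk>y < y'; y' \<le> height \<nu>\<rbrakk> \<Longrightarrow> r y < r y'"
    and region_iff: "\<lbrakk>x \<le> width \<nu>; y \<le> height \<nu>\<rbrakk> \<Longrightarrow> (x, y) \<in> region \<nu> \<longleftrightarrow> c x < r y"
    and c_0: "c 0 = 0"
    and r_height: "r (height \<nu>) \<le> n + 2"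
begin

section \<open>Crossing chords and incompatible points\<close>

lemma c_less_iff: "\<lbrakk>x \<le> width \<nu>; x' \<le> width \<nu>\<rbrakk> \<Longrightarrow> c x < c x' \<longleftrightarrow> x < x'"
  using c_less[of x x'] c_less[of x' x] by (cases x x' rule: linorder_cases) auto

lemma r_less_iff: "\<lbrakk>y \<le> height \<nu>; y' \<le> height \<nu>\<rbrakk> \<Longrightarrow> r y < r y' \<longleftrightarrow> y < y'"
  using r_less[of y y'] r_less[of y' y] by (cases y y' rule: linorder_cases) auto

lemma r_le: "y \<le> height \<nu> \<Longrightarrow> r y \<le> n + 2"
  using r_less[of y "height \<nu>"] r_height by (cases "y = height \<nu>") auto

lemma chord_inj:
  assumes "p \<in> region \<nu>" "q \<in> region \<nu>" "map_prod c r p = map_prod c r q"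
  shows "p = q"
proof -
  obtain x y x' y' where "p = (x, y)" "q = (x', y')" by fastforce
  with assms show ?thesis
    using c_less_iff[of x x'] c_less_iff[of x' x] r_less_iff[of y y'] r_less_iff[of y' y]
      region_bounds[of x y] region_bounds[of x' y'] by auto
qed

text \<open>For \<open>p = (x, y)\<close> and \<open>q = (x', y')\<close>, the pattern
  \<open>c x < c x' < r y < r y'\<close> says that \<open>p\<close> is southwest of \<open>q\<close>
  and that the southeast corner \<open>(x', y)\<close> is in the region.\<close>

lemma crossing_iff:
  assumes "p \<in> region \<nu>" "q \<in> region \<nu>"
  shows "crossing (map_prod c r p) (map_prod c r q) \<longleftrightarrow> incompatible \<nu> p q"
proof -
  obtain x y x' y' where pq: "p = (x, y)" "q = (x', y')" by fastforce
  then have bounds: "x \<le> width \<nu>" "y \<le> height \<nu>" "x' \<le> width \<nu>" "y' \<le> height \<nu>"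
    using assms region_bounds by auto
  show ?thesis
    unfolding incompatible_iff[OF assms] using pq bounds
    by (auto simp: southwest_def c_less_iff r_less_iff region_iff)
qed

lemma not_diagonal_cases:
  assumes "(x, y) \<in> region \<nu>" "map_prod c r (x, y) \<notin> diagonals n"
  shows "r y = Suc (c x) \<or> (x, y) = (0, height \<nu>)"
proof -
  have b: "x \<le> width \<nu>" "y \<le> height \<nu>" using assms region_bounds by auto
  then have *: "c x < r y" "r y \<le> n + 2" using assms region_iff r_le by auto
  show ?thesis
  proof (rule ccontr)
    assume neg: "\<not> ?thesis"
    \<comment> \<open>A chord between non-adjacent positions that is no diagonal must be the edge
      joining vertices \<open>0\<close> and \<open>n + 2\<close>.\<close>
    then have "c x = 0" "r y = n + 2" using * assms(2) by (auto simp: diagonals_def)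
    then have "x = 0" "y = height \<nu>"
      using c_less[of 0 x] r_less[of y "height \<nu>"] b r_height by (auto intro: ccontr)
    then show False using neg by simp
  qed
qed

text \<open>A row and a column at adjacent vertices meet in a valley of the path. Other points covering
  that row and that column lie to the left of the valley and above it, so they are incompatible.\<close>

lemma not_diagonal_mem_tree:
  assumes T: "schroeder_tree \<nu> T" and p: "p \<in> region \<nu>" "map_prod c r p \<notin> diagonals n"
  shows "p \<in> T"
proof -
  obtain x y where xy: "p = (x, y)" by fastforce
  then have b: "x \<le> width \<nu>" "y \<le> height \<nu>" using p region_bounds by auto
  show ?thesis
  proof (cases "p = (0, height \<nu>)")
    case True
    then show ?thesis using T by (simp add: schroeder_tree_def)
  next
    case False
    then have adj: "r y = Suc (c x)" using p xy not_diagonal_cases by blast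
    obtain x' y' where m: "(x', y) \<in> T" "(x, y') \<in> T"
      using schroeder_tree_col[OF T b(1)] schroeder_tree_row[OF T b(2)] by metis
    then have reg: "(x', y) \<in> region \<nu>" "(x, y') \<in> region \<nu>"
      using schroeder_tree_region[OF T] by auto
    then have b': "x' \<le> width \<nu>" "y' \<le> height \<nu>" using region_bounds by auto
    have "c x' < r y" "c x < r y'" using reg b b' region_iff by auto
    \<comment> \<open>A column after \<open>x\<close> would sit at or beyond \<open>r y\<close>, and
      a row before \<open>y\<close> at or before \<open>c x\<close>, because no vertex lies between
      \<open>c x\<close> and \<open>r y\<close>.\<close>
    then have "x' \<le> x" "y \<le> y'"
      using c_less[of x x'] r_less[of y' y] adj b b' by (auto intro: leI)
    moreover have "\<not> (x' < x \<and> y < y')"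
    proof
      assume "x' < x \<and> y < y'"
      then have "incompatible \<nu> (x', y) (x, y')"
        using incompatible_iff[OF reg] p xy by (simp add: southwest_def)
      then show False using T m by (auto simp: schroeder_tree_def)
    qed
    ultimately show ?thesis using m xy by (metis le_neq_implies_less)
  qed
qed

text \<open>Intersecting with the diagonals discards polygon edges. They carry no information, since
  the points behind them lie in every tree.\<close>

definition face :: "point set \<Rightarrow> (nat \<times> nat) set" where
  "face T = map_prod c r ` T \<inter> diagonals n"

lemma mem_face_iff:
  assumes "schroeder_tree \<nu> T" "p \<in> region \<nu>"
  shows "map_prod c r p \<in> face T \<longleftrightarrow> p \<in> T \<and> map_prod c r p \<in> diagonals n"
proof -
  have "p \<in> T" if "q \<in> T" "map_prod c r p = map_prod c r q" for q
  proof -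
    have "q \<in> region \<nu>" using that(1) assms(1) by (auto simp: schroeder_tree_def)
    from chord_inj[OF assms(2) this that(2)] show ?thesis using that(1) by simp
  qed
  then have "map_prod c r p \<in> map_prod c r ` T \<longleftrightarrow> p \<in> T"
    unfolding image_iff by metis
  then show ?thesis by (simp add: face_def)
qed

lemma face_dissection:
  assumes "schroeder_tree \<nu> T"
  shows "face T \<in> dissections n"
proof -
  have "\<not> crossing (map_prod c r p) (map_prod c r q)" if "p \<in> T" "q \<in> T" for p q
  proof -
    have "p \<in> region \<nu>" "q \<in> region \<nu>" "\<not> incompatible \<nu> p q"
      using that assms by (auto simp: schroeder_tree_def)
    then show ?thesis using crossing_iff by simp
  qed
  then have "\<forall>d\<in>map_prod c r ` T. \<forall>d'\<in>map_prod c r ` T. \<not> crossing d d'"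
    by (simp only: ball_simps) blast
  then show ?thesis unfolding dissections_def face_def by blast
qed

text \<open>A point of \<open>T\<close> with a diagonal as chord is recovered from
  \<open>face T'\<close> by injectivity of the chord map on the region; all other points belong to
  \<open>T'\<close> anyway.\<close>

lemma face_subset_iff:
  assumes "schroeder_tree \<nu> T" "schroeder_tree \<nu> T'"
  shows "face T \<subseteq> face T' \<longleftrightarrow> T \<subseteq> T'"
proof
  assume sub: "face T \<subseteq> face T'"
  show "T \<subseteq> T'"
  proof
    fix p assume "p \<in> T"
    then have p: "p \<in> T" "p \<in> region \<nu>" using assms by (auto simp: schroeder_tree_def)
    show "p \<in> T'"
    proof (cases "map_prod c r p \<in> diagonals n")
      case True
      then show ?thesis using sub p assms mem_face_iff by blast
    next
      case False
      then show ?thesis using p assms not_diagonal_mem_tree by blast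
    qed
  qed
next
  assume "T \<subseteq> T'"
  then show "face T \<subseteq> face T'" unfolding face_def by blast
qed

lemma face_Un: "face (T \<union> T') = face T \<union> face T'"
  unfolding face_def by blast

text \<open>Injectivity of the chord map on the region lets images commute with
  intersections.\<close>

lemma face_Int:
  assumes "schroeder_tree \<nu> T" "schroeder_tree \<nu> T'"
  shows "face (T \<inter> T') = face T \<inter> face T'"
proof -
  have "d \<in> face (T \<inter> T')" if d: "d \<in> face T" "d \<in> face T'" for d
  proof -
    obtain p where p: "p \<in> T" "d = map_prod c r p" "d \<in> diagonals n"
      using d(1) by (auto simp: face_def)
    moreover have "p \<in> region \<nu>" using p assms by (auto simp: schroeder_tree_def)
    ultimately have "p \<in> T'" using d(2) mem_face_iff[OF assms(2)] by blast
    then show ?thesis using p by (auto simp: face_def)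
  qed
  moreover have "face (T \<inter> T') \<subseteq> face T \<inter> face T'" unfolding face_def by blast
  ultimately show ?thesis by blast
qed

lemma schroeder_tree_Un:
  assumes T: "schroeder_tree \<nu> T" and T': "schroeder_tree \<nu> T'"
    and D: "face T \<union> face T' \<in> dissections n"
  shows "schroeder_tree \<nu> (T \<union> T')"
proof -
  have comp: "\<not> incompatible \<nu> p q" if pq: "p \<in> T \<union> T'" "q \<in> T \<union> T'" for p q
  proof -
    have reg: "p \<in> region \<nu>" "q \<in> region \<nu>" using pq T T' by (auto simp: schroeder_tree_def)
    show ?thesis
    proof (cases "map_prod c r p \<in> diagonals n \<and> map_prod c r q \<in> diagonals n")
      case True
      then have "map_prod c r p \<in> face T \<union> face T'" "map_prod c r q \<in> face T \<union> face T'"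
        using pq by (auto simp: face_def)
      then show ?thesis using D crossing_iff[OF reg] unfolding dissections_def by blast
    next
      case False
      \<comment> \<open>A point whose chord is no diagonal is in both trees, so \<open>p\<close> and
        \<open>q\<close> share a tree and are compatible there.\<close>
      then have "p \<in> T \<inter> T' \<or> q \<in> T \<inter> T'"
        using reg T T' not_diagonal_mem_tree by blast
      then show ?thesis using pq T T' by (auto simp: schroeder_tree_def)
    qed
  qed
  have "T \<union> T' \<subseteq> region \<nu>" using T T' by (auto simp: schroeder_tree_def)
  moreover have "\<exists>y. (x, y) \<in> T \<union> T'" if "x \<le> width \<nu>" for x
    using schroeder_tree_col[OF T that] by blast
  moreover have "\<exists>x. (x, y) \<in> T \<union> T'" if "y \<le> height \<nu>" for y
    using schroeder_tree_row[OF T that] by blast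
  ultimately show ?thesis
    using comp schroeder_tree_root[OF T] by (simp add: schroeder_tree_def)
qed

end

section \<open>The staircase path\<close>

text \<open>A prefix of \<open>s # \<nu>\<close> is empty or is \<open>s\<close> followed by a
  prefix of \<open>\<nu>\<close>, whose endpoint gets shifted by the step \<open>s\<close>.\<close>

lemma path_points_Cons:
  "path_points (s # \<nu>) = insert (0, 0)
    ((\<lambda>(x, y). case s of N \<Rightarrow> (x, Suc y) | E \<Rightarrow> (Suc x, y)) ` path_points \<nu>)" (is "_ = ?R")
proof (rule Set.set_eqI)
  fix p
  have "p \<in> path_points (s # \<nu>) \<longleftrightarrow>
      p = (0, 0) \<or> (\<exists>k\<le>length \<nu>. p = (width (s # take k \<nu>), height (s # take k \<nu>)))"
  proof -
    have "(\<exists>k\<le>Suc (length \<nu>). P k) \<longleftrightarrow> P 0 \<or> (\<exists>k\<le>length \<nu>. P (Suc k))" for P :: "nat \<Rightarrow> bool"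
      by (metis Suc_le_mono not0_implies_Suc zero_le)
    from this[of "\<lambda>k. p = (width (take k (s # \<nu>)), height (take k (s # \<nu>)))"]
    show ?thesis by (simp add: path_points_def conj_commute)
  qed
  also have "\<dots> \<longleftrightarrow> p \<in> ?R"
    by (cases s) (auto simp: path_points_def)
  finally show "p \<in> path_points (s # \<nu>) \<longleftrightarrow> p \<in> ?R" .
qed

definition staircase :: "nat \<Rightarrow> step list" where
  "staircase m = concat (replicate m [N, E])"

lemma staircase_simps: "staircase 0 = []" "staircase (Suc m) = N # E # staircase m"
  by (simp_all add: staircase_def)

lemma width_staircase: "width (staircase m) = m"
  by (induction m) (auto simp: staircase_simps)

lemma height_staircase: "height (staircase m) = m"
  by (induction m) (auto simp: staircase_simps)

lemma path_points_staircase: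
  "(x, y) \<in> path_points (staircase m) \<longleftrightarrow> x \<le> m \<and> y \<le> m \<and> (y = x \<or> y = Suc x)"
proof (induction m arbitrary: x y)
  case 0
  then show ?case by (auto simp: path_points_def staircase_simps)
next
  case (Suc m)
  have "(x, y) \<in> path_points (staircase (Suc m)) \<longleftrightarrow>
    (x, y) \<in> {(0, 0), (0, 1)} \<or> (\<exists>u v. x = Suc u \<and> y = Suc v \<and> (u, v) \<in> path_points (staircase m))"
    by (auto simp: path_points_Cons staircase_simps image_iff)
  then show ?case unfolding Suc.IH by (cases x; cases y) auto
qed

lemma region_staircase: "(x, y) \<in> region (staircase m) \<longleftrightarrow> x \<le> y \<and> y \<le> m"
  unfolding region_def
  by (auto simp: path_points_staircase width_staircase height_staircase)

text \<open>Column \<open>x\<close> sits at vertex \<open>x\<close> and row \<open>y\<close> at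
  vertex \<open>y + 1\<close>. Valleys \<open>(x, x)\<close> become edges between neighbouring
  vertices, and the root becomes the edge \<open>(0, n + 2)\<close>.\<close>

lemma grid_embedding_staircase: "grid_embedding (staircase (n + 1)) n id Suc"
  by unfold_locales
    (unfold region_staircase width_staircase height_staircase, auto)

context
  fixes n :: nat
begin

interpretation grid_embedding "staircase (n + 1)" n id Suc
  by (rule grid_embedding_staircase)

text \<open>The preimage of \<open>D\<close> consists of all points whose chord is in
  \<open>D\<close> or is an edge. Edges cross nothing, and the valleys among them already cover
  every row and column.\<close>

lemma staircase_face_surj:
  assumes D: "D \<in> dissections n"
  shows "\<exists>T. schroeder_tree (staircase (n + 1)) T \<and> face T = D"
proof -
  let ?R = "region (staircase (n + 1))"
  define T where "T = {p \<in> ?R. map_prod id Suc p \<in> D \<or> map_prod id Suc p \<notin> diagonals n}"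
  have edge: "\<not> crossing (map_prod id Suc p) (map_prod id Suc q)"
      "\<not> crossing (map_prod id Suc q) (map_prod id Suc p)"
    if "p \<in> ?R" "q \<in> ?R" "map_prod id Suc p \<notin> diagonals n" for p q
  proof -
    obtain x y u v where pq: "p = (x, y)" "q = (u, v)" by fastforce
    then have "x \<le> y" "y \<le> n + 1" "u \<le> v" "v \<le> n + 1"
      using that(1,2) by (auto simp: region_staircase)
    moreover from this have "y = x \<or> x = 0 \<and> y = n + 1"
      using that(3) pq by (auto simp: diagonals_def)
    ultimately show "\<not> crossing (map_prod id Suc p) (map_prod id Suc q)"
        "\<not> crossing (map_prod id Suc q) (map_prod id Suc p)"
      using pq by auto
  qed
  have comp: "\<not> incompatible (staircase (n + 1)) p q" if "p \<in> T" "q \<in> T" for p q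
  proof -
    have "\<not> crossing (map_prod id Suc p) (map_prod id Suc q)"
      using that edge D unfolding T_def dissections_def by blast
    then show ?thesis using that crossing_iff unfolding T_def by blast
  qed
  have valley: "(x, x) \<in> T" if "x \<le> n + 1" for x
    using that unfolding T_def mem_Collect_eq region_staircase by (auto simp: diagonals_def)
  have root: "(0, n + 1) \<in> T"
    unfolding T_def mem_Collect_eq region_staircase by (auto simp: diagonals_def)
  have "schroeder_tree (staircase (n + 1)) T"
    unfolding schroeder_tree_def width_staircase height_staircase
  proof (intro conjI)
    show "T \<subseteq> ?R" by (auto simp: T_def)
  qed (use comp valley root in blast)+
  moreover have "face T = D"
  proof
    show "D \<subseteq> face T"
    proof
      fix d assume d: "d \<in> D"
      obtain i j where ij: "d = (i, j)" by fastforce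
      have dd: "d \<in> diagonals n" using d D by (auto simp: dissections_def)
      \<comment> \<open>The row at vertex \<open>j\<close> is \<open>j - 1\<close>; the subtraction
        does not truncate, as a diagonal has \<open>j \<ge> 2\<close>.\<close>
      then have *: "(i, j - 1) \<in> ?R" "map_prod id Suc (i, j - 1) = d"
        using ij unfolding region_staircase by (auto simp: diagonals_def)
      then have "(i, j - 1) \<in> T" using d by (auto simp: T_def)
      then show "d \<in> face T" using dd *(2) unfolding face_def by (metis IntI imageI)
    qed
  qed (auto simp: face_def T_def)
  ultimately show ?thesis by blast
qed

lemma staircase_order_isomorphic:
  "order_isomorphic (adjoin_bot (schroeder_tree_poset (staircase (n + 1))))
    (associahedron_face_lattice n)"
proof (rule order_isomorphicI[where f = "map_option face"])
  let ?P = "adjoin_bot (schroeder_tree_poset (staircase (n + 1)))"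
  show "partial_order ?P"
    by (intro partial_order_adjoin_bot partial_order_tree_poset)
  show "partial_order (associahedron_face_lattice n)"
    by (rule partial_order_face_lattice)
  have carrier: "carrier ?P = insert None (Some ` {T. schroeder_tree (staircase (n + 1)) T})"
    by (simp add: adjoin_bot_def discrete_eq_order_def tree_poset_carrier)
  have "face ` {T. schroeder_tree (staircase (n + 1)) T} = dissections n"
    using face_dissection staircase_face_surj by blast
  moreover have "map_option face ` Some ` X = Some ` face ` X" for X
    by (simp add: image_image)
  ultimately show "map_option face ` carrier ?P = carrier (associahedron_face_lattice n)"
    unfolding carrier face_lattice_carrier by simp
  fix s t assume st: "s \<in> carrier ?P" "t \<in> carrier ?P"
  show "map_option face s \<sqsubseteq>\<^bsub>associahedron_face_lattice n\<^esub> map_option face t \<longleftrightarrow> s \<sqsubseteq>\<^bsub>?P\<^esub> t"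
    using st unfolding carrier
    by (auto simp: adjoin_bot_def discrete_eq_order_def tree_poset_le face_subset_iff)
qed

end

section \<open>General paths\<close>

text \<open>Listing column \<open>0\<close>, then for each step of \<open>\<nu>\<close> the row left by an \<open>N\<close> or the column entered
  by an \<open>E\<close>, and finally the top row, puts column \<open>x\<close> at position \<open>col_pos \<nu> x\<close> and row \<open>y\<close> at
  position \<open>row_pos \<nu> y\<close>.\<close>

definition col_pos :: "step list \<Rightarrow> nat \<Rightarrow> nat" where
  "col_pos \<nu> x = x + card {y. y \<le> height \<nu> \<and> (x, y) \<notin> region \<nu>}"

definition row_pos :: "step list \<Rightarrow> nat \<Rightarrow> nat" where
  "row_pos \<nu> y = y + card {x. (x, y) \<in> region \<nu>}"

text \<open>A finite down-closed set of naturals is an initial segment, so its cardinality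
  determines it.\<close>

lemma down_closed_mem_iff:
  fixes A :: "nat set"
  assumes "finite A" "\<And>x x'. \<lbrakk>x \<in> A; x' \<le> x\<rbrakk> \<Longrightarrow> x' \<in> A"
  shows "x \<in> A \<longleftrightarrow> x < card A"
proof
  assume "x \<in> A"
  then have "{..x} \<subseteq> A" using assms(2) by auto
  then show "x < card A" using card_mono[OF assms(1), of "{..x}"] by simp
next
  assume less: "x < card A"
  show "x \<in> A"
  proof (rule ccontr)
    assume "x \<notin> A"
    then have "A \<subseteq> {..<x}" using assms(2) by (meson leI lessThan_iff subsetI)
    then show False using less card_mono[of "{..<x}" A] by simp
  qed
qed

lemma finite_region_row: "finite {x. (x, y) \<in> region \<nu>}"
  by (rule finite_subset[of _ "{..width \<nu>}"]) (auto simp: region_def)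

text \<open>Row \<open>y\<close> meets the region in an initial segment of columns, and column
  \<open>x\<close> misses it in an initial segment of rows. Membership of \<open>(x, y)\<close>
  bounds \<open>x\<close> and \<open>y\<close> by the two cardinalities, non-membership reverses
  both bounds, and adding them compares the positions.\<close>

lemma region_iff_pos:
  assumes "x \<le> width \<nu>" "y \<le> height \<nu>"
  shows "(x, y) \<in> region \<nu> \<longleftrightarrow> col_pos \<nu> x < row_pos \<nu> y"
proof -
  have "(x, y) \<in> region \<nu> \<longleftrightarrow> x < card {x. (x, y) \<in> region \<nu>}"
    using down_closed_mem_iff[of "{x. (x, y) \<in> region \<nu>}" x] finite_region_row region_left by blast
  moreover have "(x, y) \<notin> region \<nu> \<longleftrightarrow> y < card {y. y \<le> height \<nu> \<and> (x, y) \<notin> region \<nu>}"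
    using down_closed_mem_iff[of "{y. y \<le> height \<nu> \<and> (x, y) \<notin> region \<nu>}" y] assms(2) region_up
    by fastforce
  ultimately show ?thesis unfolding col_pos_def row_pos_def by linarith
qed

lemma row_pos_height: "row_pos \<nu> (height \<nu>) = length \<nu> + 1"
proof -
  have "{x. (x, height \<nu>) \<in> region \<nu>} = {..width \<nu>}"
    using region_top region_bounds by auto
  then show ?thesis by (simp add: row_pos_def length_eq_height_plus_width)
qed

text \<open>The coordinate summand makes the positions strictly increasing; the cardinality summand
  is only weakly monotone.\<close>

lemma grid_embedding_pos: "grid_embedding \<nu> (length \<nu>) (col_pos \<nu>) (row_pos \<nu>)"
proof
  show "col_pos \<nu> x < col_pos \<nu> x'" if "x < x'" for x x'
    unfolding col_pos_def
    by (intro add_less_le_mono card_mono) (use that region_left less_imp_le in auto)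
  show "row_pos \<nu> y < row_pos \<nu> y'" if "y < y'" "y' \<le> height \<nu>" for y y'
    unfolding row_pos_def
    by (intro add_less_le_mono card_mono finite_region_row) (use that region_up in auto)
  show "col_pos \<nu> 0 = 0"
    using region_leftmost by (auto simp: col_pos_def)
qed (auto simp: region_iff_pos row_pos_height)

context
  fixes \<nu> :: "step list"
begin

interpretation grid_embedding \<nu> "length \<nu>" "col_pos \<nu>" "row_pos \<nu>"
  by (rule grid_embedding_pos)

section \<open>The sublattice formed by the faces of trees\<close>

abbreviation (input) \<A> where "\<A> \<equiv> associahedron_face_lattice (length \<nu>)"

text \<open>The outer \<open>None\<close> is the adjoined top and goes to the empty dissection, the
  whole polytope; \<open>Some None\<close> is the adjoined bottom and goes to the empty
  face.\<close>

definition tree_face :: "point set option option \<Rightarrow> (nat \<times> nat) set option" where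
  "tree_face t = (case t of None \<Rightarrow> Some {} | Some t' \<Rightarrow> map_option face t')"

definition tree_faces :: "(nat \<times> nat) set option set" where
  "tree_faces = insert (Some {}) (insert None ((\<lambda>T. Some (face T)) ` {T. schroeder_tree \<nu> T}))"

text \<open>The \<open>(length \<nu> + 3)\<close>-gon has one vertex more than there are rows and columns, so the
  root is a genuine diagonal.\<close>

lemma face_nonempty:
  assumes "\<nu> \<noteq> []" "schroeder_tree \<nu> T"
  shows "face T \<noteq> {}"
proof -
  have "(0, height \<nu>) \<in> T" using assms(2) by (simp add: schroeder_tree_def)
  moreover have "(0, length \<nu> + 1) \<in> diagonals (length \<nu>)"
    using assms(1) by (cases \<nu>) (auto simp: diagonals_def)
  ultimately have "(0, length \<nu> + 1) \<in> face T"
    unfolding face_def by (force simp: c_0 row_pos_height)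
  then show ?thesis by blast
qed

lemma tree_faces_subset: "tree_faces \<subseteq> carrier \<A>"
  using face_dissection by (auto simp: tree_faces_def face_lattice_carrier dissections_def)

text \<open>If the union of two tree faces has no crossing, the union of the trees is a tree;
  otherwise the meet is the empty face. The top \<open>Some {}\<close> is neutral for
  unions.\<close>

lemma tree_faces_meet:
  assumes "x \<in> tree_faces" "y \<in> tree_faces"
  shows "\<exists>m\<in>tree_faces. greatest \<A> m (Lower \<A> {x, y})"
proof (cases "x = None \<or> y = None")
  case True
  then have "{x, y} = {None, x} \<or> {x, y} = {None, y}" by auto
  then have "greatest \<A> None (Lower \<A> {x, y})"
    using face_lattice_meet_None[of x] face_lattice_meet_None[of y] assms tree_faces_subset
    by (elim disjE) auto
  moreover have "None \<in> tree_faces" by (simp add: tree_faces_def)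
  ultimately show ?thesis by blast
next
  case False
  then obtain D D' where xy: "x = Some D" "y = Some D'" by auto
  have *: "D \<in> dissections (length \<nu>)" "D' \<in> dissections (length \<nu>)"
    using assms xy tree_faces_subset by (auto simp: face_lattice_carrier)
  have "Some (D \<union> D') \<in> tree_faces" if "D \<union> D' \<in> dissections (length \<nu>)"
  proof (cases "D = {} \<or> D' = {}")
    case True
    then show ?thesis using assms xy by auto
  next
    case False
    then obtain T T' where T: "schroeder_tree \<nu> T" "D = face T" "schroeder_tree \<nu> T'" "D' = face T'"
      using assms xy by (auto simp: tree_faces_def)
    then have "schroeder_tree \<nu> (T \<union> T')" using that schroeder_tree_Un by blast
    moreover have "D \<union> D' = face (T \<union> T')" using T face_Un by simp
    ultimately show ?thesis unfolding tree_faces_def by blast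
  qed
  then have "(if D \<union> D' \<in> dissections (length \<nu>) then Some (D \<union> D') else None) \<in> tree_faces"
    by (simp add: tree_faces_def)
  then show ?thesis using face_lattice_meet_Some[OF *] xy by blast
qed

text \<open>A bound \<open>u\<close> other than the top supplies a tree \<open>U\<close> contained
  in both trees, which makes their intersection a tree.\<close>

lemma tree_faces_join:
  assumes "x \<in> tree_faces" "y \<in> tree_faces" "u \<in> tree_faces" "u \<noteq> Some {}"
    and le: "x \<sqsubseteq>\<^bsub>\<A>\<^esub> u" "y \<sqsubseteq>\<^bsub>\<A>\<^esub> u"
  shows "\<exists>j\<in>tree_faces. least \<A> j (Upper \<A> {x, y})"
proof (cases "x = None \<or> y = None")
  case True
  then have "{x, y} = {None, x} \<or> {x, y} = {None, y}" by auto
  moreover have "least \<A> x (Upper \<A> {None, x})" "least \<A> y (Upper \<A> {None, y})"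
    using face_lattice_join_None assms(1,2) tree_faces_subset by blast+
  ultimately show ?thesis using assms(1,2) by metis
next
  case False
  then obtain D D' where xy: "x = Some D" "y = Some D'" by auto
  have "u \<noteq> None" using le(1) xy(1) by (cases u) auto
  then obtain U where U: "schroeder_tree \<nu> U" "u = Some (face U)"
    using assms(3,4) by (auto simp: tree_faces_def)
  then have sub: "face U \<subseteq> D" "face U \<subseteq> D'" using le xy by auto
  \<comment> \<open>Hence \<open>D\<close> and \<open>D'\<close> are non-empty and come from trees,
    not from the adjoined top.\<close>
  moreover have "face U \<noteq> {}" using assms(4) U by auto
  ultimately obtain T T'
    where T: "schroeder_tree \<nu> T" "D = face T" "schroeder_tree \<nu> T'" "D' = face T'"
    using assms(1,2) xy by (auto simp: tree_faces_def)
  then have "U \<subseteq> T \<inter> T'" using sub U face_subset_iff by blast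
  then have "schroeder_tree \<nu> (T \<inter> T')"
    using schroeder_tree_between[OF T(1) U(1)] by blast
  moreover have "D \<inter> D' = face (T \<inter> T')" using T face_Int by simp
  ultimately have "Some (D \<inter> D') \<in> tree_faces" unfolding tree_faces_def by blast
  moreover have "D \<in> dissections (length \<nu>)" "D' \<in> dissections (length \<nu>)"
    using T face_dissection by auto
  ultimately show ?thesis using face_lattice_join_Some xy by blast
qed

lemma tree_faces_induced_sublattice: "induced_sublattice \<A> tree_faces"
proof (rule induced_sublatticeI)
  show "Some {} \<in> tree_faces" by (simp add: tree_faces_def)
  show "x \<sqsubseteq>\<^bsub>\<A>\<^esub> Some {}" for x by (cases x) auto
qed (use lattice_face_lattice tree_faces_subset tree_faces_meet tree_faces_join in auto)

text \<open>For a non-empty path every tree has a non-empty face, so the image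
  \<open>Some {}\<close> of the adjoined top stays distinct from all tree faces. For the empty path
  they would collide.\<close>

lemma tree_faces_order_isomorphic:
  assumes "\<nu> \<noteq> []"
  shows "order_isomorphic (adjoin_top (adjoin_bot (schroeder_tree_poset \<nu>)))
    (\<A>\<lparr>carrier := tree_faces\<rparr>)"
proof (rule order_isomorphicI[where f = tree_face])
  let ?P = "adjoin_top (adjoin_bot (schroeder_tree_poset \<nu>))"
  show "partial_order ?P"
    by (intro partial_order_adjoin_top partial_order_adjoin_bot partial_order_tree_poset)
  show "partial_order (\<A>\<lparr>carrier := tree_faces\<rparr>)"
    by (intro partial_order_subset partial_order_face_lattice tree_faces_subset)
  have carrier: "carrier ?P =
      insert None (insert (Some None) ((\<lambda>T. Some (Some T)) ` {T. schroeder_tree \<nu> T}))"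
    by (simp add: adjoin_bot_def adjoin_top_def discrete_eq_order_def tree_poset_carrier image_image)
  show "tree_face ` carrier ?P = carrier (\<A>\<lparr>carrier := tree_faces\<rparr>)"
    unfolding carrier by (simp add: tree_faces_def tree_face_def image_image)
  fix s t assume "s \<in> carrier ?P" "t \<in> carrier ?P"
  then show "tree_face s \<sqsubseteq>\<^bsub>\<A>\<lparr>carrier := tree_faces\<rparr>\<^esub> tree_face t \<longleftrightarrow> s \<sqsubseteq>\<^bsub>?P\<^esub> t"
    unfolding carrier
    by (auto simp: tree_face_def adjoin_top_def adjoin_bot_def discrete_eq_order_def tree_poset_le
        face_subset_iff face_nonempty[OF assms])
qed

end

theorem corollary4p10:
  shows "(\<forall>n::nat.
            order_isomorphic
              (adjoin_bot (schroeder_tree_poset (concat (replicate (n + 1) [N, E]))))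
              (associahedron_face_lattice n)) \<and>
         (\<forall>\<nu> :: step list. \<nu> \<noteq> [] \<longrightarrow>
            (\<exists>S. induced_sublattice (associahedron_face_lattice (length \<nu>)) S \<and>
                 order_isomorphic
                   (adjoin_top (adjoin_bot (schroeder_tree_poset \<nu>)))
                   ((associahedron_face_lattice (length \<nu>))\<lparr>carrier := S\<rparr>)))"
proof (intro conjI allI impI)
  show "order_isomorphic (adjoin_bot (schroeder_tree_poset (concat (replicate (n + 1) [N, E]))))
      (associahedron_face_lattice n)" for n
    using staircase_order_isomorphic[of n] by (simp only: staircase_def)
  show "\<exists>S. induced_sublattice (associahedron_face_lattice (length \<nu>)) S \<and>
      order_isomorphic (adjoin_top (adjoin_bot (schroeder_tree_poset \<nu>)))
        ((associahedron_face_lattice (length \<nu>))\<lparr>carrier := S\<rparr>)" if "\<nu> \<noteq> []" for \<nu>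
    using tree_faces_induced_sublattice tree_faces_order_isomorphic[OF that] by blast
qed

end
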